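(* Let $n<7$ and let $\Omega\subset\mathbb{R}^n$ be a domain. There is no singular stable solution of $\Delta u=\frac1u$ on $\Omega$; that is, if $u_j$ are positive stable solutions of $\Delta u_j=\frac1{u_j}$ on $\Omega$ converging uniformly on $\Omega$ to a function $u\ge0$, then $u$ has no zero in $\Omega$.
   Context: A positive (smooth) solution $v$ of $\Delta v=\frac1v$ on $\Omega$ is called stable if $\int_\Omega \frac{\zeta^2}{v^2}\le\int_\Omega|D\zeta|^2$ for all test functions $\zeta\in C_c^1(\Omega)$. A singular stable solution is a nonnegative function $u$ on $\Omega$ which is a uniform limit of positive stable solutions and which vanishes at some point of $\Omega$. *)

theory Defs
  imports "HOL-Analysis.Analysis"
begin

definition partial_deriv :: "'n::finite \<Rightarrow> (real ^ 'n \<Rightarrow> real) \<Rightarrow> real ^ 'n \<Rightarrow> real" where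
  "partial_deriv i f x = frechet_derivative f (at x) (axis i 1)"

definition grad :: "(real ^ 'n::finite \<Rightarrow> real) \<Rightarrow> real ^ 'n \<Rightarrow> real ^ 'n" where
  "grad f x = (\<chi> i. partial_deriv i f x)"

definition laplacian :: "(real ^ 'n::finite \<Rightarrow> real) \<Rightarrow> real ^ 'n \<Rightarrow> real" where
  "laplacian f x = (\<Sum>i\<in>UNIV. partial_deriv i (partial_deriv i f) x)"

(* Meant for open S only.  Functions on S are modelled by total functions whose
   values outside S do not matter. *)
primrec Ck_on :: "nat \<Rightarrow> (real ^ 'n::finite \<Rightarrow> real) \<Rightarrow> (real ^ 'n) set \<Rightarrow> bool" where
  "Ck_on 0 f S \<longleftrightarrow> continuous_on S f"
| "Ck_on (Suc k) f S \<longleftrightarrow>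
     (\<forall>x\<in>S. f differentiable (at x)) \<and> (\<forall>i. Ck_on k (partial_deriv i f) S)"

definition smooth_on :: "(real ^ 'n::finite \<Rightarrow> real) \<Rightarrow> (real ^ 'n) set \<Rightarrow> bool" where
  "smooth_on f S \<longleftrightarrow> (\<forall>k. Ck_on k f S)"

(* The space C_c^1 of Omega; its members are taken to be extended by zero to the whole space. *)
definition test_function :: "(real ^ 'n::finite) set \<Rightarrow> (real ^ 'n \<Rightarrow> real) \<Rightarrow> bool" where
  "test_function \<Omega> \<zeta> \<longleftrightarrow>
     Ck_on 1 \<zeta> UNIV \<and> compact (closure {x. \<zeta> x \<noteq> 0}) \<and> closure {x. \<zeta> x \<noteq> 0} \<subseteq> \<Omega>"

definition positive_solution :: "(real ^ 'n::finite) set \<Rightarrow> (real ^ 'n \<Rightarrow> real) \<Rightarrow> bool" where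
  "positive_solution \<Omega> v \<longleftrightarrow>
     smooth_on v \<Omega> \<and> (\<forall>x\<in>\<Omega>. v x > 0) \<and> (\<forall>x\<in>\<Omega>. laplacian v x = 1 / v x)"

(* For open Omega and v positive and continuous on Omega, both integrands are continuous with
   compact support in Omega, so the integrals are never the default value 0 of a
   non-integrable function. *)
definition stable_on :: "(real ^ 'n::finite) set \<Rightarrow> (real ^ 'n \<Rightarrow> real) \<Rightarrow> bool" where
  "stable_on \<Omega> v \<longleftrightarrow>
     (\<forall>\<zeta>. test_function \<Omega> \<zeta> \<longrightarrow>
        (LINT x:\<Omega>|lborel. (\<zeta> x)\<^sup>2 / (v x)\<^sup>2) \<le> (LINT x:\<Omega>|lborel. (norm (grad \<zeta> x))\<^sup>2))"

definition singular_stable_solution :: "(real ^ 'n::finite) set \<Rightarrow> (real ^ 'n \<Rightarrow> real) \<Rightarrow> bool" where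
  "singular_stable_solution \<Omega> u \<longleftrightarrow>
     (\<forall>x\<in>\<Omega>. u x \<ge> 0) \<and>
     (\<exists>v :: nat \<Rightarrow> real ^ 'n \<Rightarrow> real.
        (\<forall>j. positive_solution \<Omega> (v j) \<and> stable_on \<Omega> (v j)) \<and>
        uniform_limit \<Omega> v u sequentially) \<and>
     (\<exists>x\<in>\<Omega>. u x = 0)"

end

theory Submission
  imports Defs
begin

text \<open>
  Write \<open>n\<close> for the dimension and \<open>q = 13/2\<close>, so that \<open>n \<le> 6 < q\<close>.  Stability bounds the integral
  of \<open>v powr (-q)\<close> over a small ball by a constant that does not depend on the stable solution \<open>v\<close>
  (\<open>stable_inverse_power_bound\<close>).  This comes from testing stability with \<open>v powr (-9/4) * \<eta>\<close> and the
  equation with \<open>v powr (-11/2) * \<eta>\<^sup>2\<close>: for the exponent \<open>a = 9/4\<close>, the two relations can be combined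
  because \<open>a\<^sup>2 < 2 * a + 1\<close>, that is, \<open>a < 1 + sqrt 2\<close>, and they control the power \<open>2 * a + 2 = q\<close>.
  The interval \<open>6 < 2 * a + 2 < 4 + 2 * sqrt 2\<close> of admissible exponents is not empty, and this is
  where the restriction \<open>n < 7\<close> comes from.

  Such a bound is incompatible with a very small value of \<open>v\<close> at a point \<open>x0\<close>.  Since \<open>\<Delta> v = 1/v\<close>, the
  weighted mean of \<open>v\<close> over the ball of radius \<open>r\<close> around \<open>x0\<close> grows with \<open>r\<close> at a rate given by the
  integral of \<open>1/v\<close>, and the bound on \<open>v powr (-q)\<close> makes this rate at most a constant
  (\<open>positive_solution_mean_growth\<close>).  If \<open>v x0 \<le> r\<close>, then the mean is therefore at most a constant times
  \<open>r\<close>, hence the mean of \<open>v powr (-q)\<close> is at least a constant times \<open>r powr (-q)\<close>, and the integral of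
  \<open>v powr (-q)\<close> over the ball is at least a constant times \<open>r powr (n - q)\<close>.  As \<open>n < q\<close>, this exceeds the
  uniform bound once \<open>r\<close> is small.  So \<open>v x0\<close> has a positive lower bound that is the same for all stable
  solutions (\<open>stable_solution_lower_bound\<close>), and a limit of stable solutions cannot vanish at \<open>x0\<close>.

  Integration by parts only concerns compactly supported functions, where it reduces to the translation
  invariance of Lebesgue measure (\<open>integral_grad_eq_0\<close>).
\<close>

section \<open>Compactly supported C1 functions\<close>

text \<open>
  Carrying the gradient as an explicit argument avoids computing Frechet derivatives again after every
  product or composition.
\<close>

definition C1_with_grad :: "'a::euclidean_space set \<Rightarrow> ('a \<Rightarrow> real) \<Rightarrow> ('a \<Rightarrow> 'a) \<Rightarrow> bool" where
  "C1_with_grad \<Omega> f Df \<longleftrightarrow> (\<forall>x\<in>\<Omega>. GDERIV f x :> Df x) \<and> continuous_on \<Omega> Df"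

text \<open>
  The support is located by a set \<open>K\<close> outside of which both the function and its gradient vanish; this is
  what makes products with functions that are meaningful only near \<open>K\<close> differentiable everywhere.
\<close>

definition C1_supported :: "'a::euclidean_space set \<Rightarrow> ('a \<Rightarrow> real) \<Rightarrow> ('a \<Rightarrow> 'a) \<Rightarrow> bool" where
  "C1_supported K f Df \<longleftrightarrow> C1_with_grad UNIV f Df \<and> (\<forall>x. x \<notin> K \<longrightarrow> f x = 0 \<and> Df x = 0)"

lemma C1_with_grad_imp_continuous_on:
  assumes "C1_with_grad \<Omega> f Df"
  shows "continuous_on \<Omega> f"
  using assms unfolding C1_with_grad_def gderiv_def
  by (intro continuous_at_imp_continuous_on ballI has_derivative_continuous) auto

lemma C1_supported_continuous:
  assumes "C1_supported K f Df"
  shows "continuous_on A f" "continuous_on A Df"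
  using assms C1_with_grad_imp_continuous_on continuous_on_subset
  unfolding C1_supported_def C1_with_grad_def by blast+

lemma continuous_on_zero_extension:
  fixes f :: "'a::euclidean_space \<Rightarrow> 'b::real_normed_vector"
  assumes "open \<Omega>" "compact K" "K \<subseteq> \<Omega>" "continuous_on \<Omega> f" "\<And>x. x \<notin> K \<Longrightarrow> f x = 0"
  shows "continuous_on UNIV f"
proof -
  have "continuous_on (- K) f"
    using continuous_on_cong[of "- K" "- K" f "\<lambda>_. 0"] assms(5) by simp
  then have "continuous_on (\<Omega> \<union> - K) f"
    using assms by (intro continuous_on_open_Un) (auto simp: compact_imp_closed)
  moreover have "\<Omega> \<union> - K = UNIV"
    using assms(3) by auto
  ultimately show ?thesis
    by simp
qed

lemma integrable_compact_support:
  fixes f :: "'a::euclidean_space \<Rightarrow> real"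
  assumes "compact K" "continuous_on K f" "\<And>x. x \<notin> K \<Longrightarrow> f x = 0"
  shows "integrable lborel f"
proof -
  have "(\<lambda>x. indicator K x *\<^sub>R f x) = f"
    using assms(3) by (auto simp: fun_eq_iff indicator_def)
  then show ?thesis
    using borel_integrable_compact[OF assms(1,2)] by simp
qed

text \<open>
  The factor \<open>f\<close> is arbitrary outside \<open>\<Omega>\<close>.  This is harmless since \<open>\<Omega>\<close> and the complement of \<open>K\<close>
  form an open cover of the space, and the product vanishes on the latter.
\<close>

lemma C1_supported_mult:
  assumes "open \<Omega>" "compact K" "K \<subseteq> \<Omega>" "C1_with_grad \<Omega> f Df" "C1_supported K \<eta> D\<eta>"
  shows "C1_supported K (\<lambda>x. f x * \<eta> x) (\<lambda>x. f x *\<^sub>R D\<eta> x + \<eta> x *\<^sub>R Df x)"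
proof -
  have zero: "\<eta> x = 0" "D\<eta> x = 0" if "x \<notin> K" for x
    using assms(5) that by (auto simp: C1_supported_def)
  have "GDERIV (\<lambda>x. f x * \<eta> x) x :> f x *\<^sub>R D\<eta> x + \<eta> x *\<^sub>R Df x" for x
  proof (cases "x \<in> \<Omega>")
    case True
    then show ?thesis
      using assms(4,5) by (intro GDERIV_mult) (auto simp: C1_supported_def C1_with_grad_def)
  next
    case False
    then have "x \<in> - K"
      using assms(3) by auto
    have "((\<lambda>x. f x * \<eta> x) has_derivative (\<lambda>h. 0)) (at x)"
    proof (rule has_derivative_transform_within_open[where f = "\<lambda>_. 0" and s = "- K"])
      show "open (- K)"
        using compact_imp_closed[OF assms(2)] by auto
    qed (use \<open>x \<in> - K\<close> zero in auto)
    then show ?thesis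
      using zero \<open>x \<in> - K\<close> by (simp add: gderiv_def)
  qed
  moreover have "continuous_on UNIV (\<lambda>x. f x *\<^sub>R D\<eta> x + \<eta> x *\<^sub>R Df x)"
  proof (rule continuous_on_zero_extension[OF assms(1-3)])
    show "continuous_on \<Omega> (\<lambda>x. f x *\<^sub>R D\<eta> x + \<eta> x *\<^sub>R Df x)"
      using assms(4,5) C1_with_grad_imp_continuous_on[OF assms(4)] C1_supported_continuous[OF assms(5)]
      by (intro continuous_intros) (auto simp: C1_with_grad_def)
  qed (simp add: zero)
  ultimately show ?thesis
    using zero by (simp add: C1_supported_def C1_with_grad_def)
qed

lemma lborel_integral_translate:
  fixes f :: "'a::euclidean_space \<Rightarrow> real"
  assumes "continuous_on UNIV f"
  shows "(LINT x|lborel. f (c + x)) = (LINT x|lborel. f x)"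
proof -
  have [measurable]: "f \<in> borel_measurable borel"
    using assms by (rule borel_measurable_continuous_onI)
  have "(LINT x|lborel. f x) = (LINT x|distr lborel borel ((+) c). f x)"
    by (simp add: lborel_distr_plus)
  also have "\<dots> = (LINT x|lborel. f (c + x))"
    by (intro integral_distr) auto
  finally show ?thesis ..
qed

text \<open>
  The difference quotients of \<open>f\<close> in the direction \<open>e\<close> integrate to 0 by translation invariance, and they
  converge to the directional derivative.  The mean value theorem dominates them by a multiple of the
  indicator function of one large ball.
\<close>

lemma integral_grad_eq_0:
  fixes f :: "'a::euclidean_space \<Rightarrow> real"
  assumes "compact K" "C1_supported K f Df"
  shows "(LINT x|lborel. Df x \<bullet> e) = 0"
proof -
  have cont: "continuous_on A f" "continuous_on A Df" for A
    using C1_supported_continuous[OF assms(2)] by auto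
  have zero: "f x = 0" "Df x = 0" if "x \<notin> K" for x
    using assms(2) that by (auto simp: C1_supported_def)
  have deriv: "(f has_derivative (\<lambda>h. h \<bullet> Df x)) (at x)" for x
    using assms(2) by (auto simp: C1_supported_def C1_with_grad_def gderiv_def)
  obtain B where B: "B \<ge> 0" "\<And>x. \<bar>Df x \<bullet> e\<bar> \<le> B"
  proof -
    have "compact ((\<lambda>x. Df x \<bullet> e) ` K)"
      using assms(1) cont by (intro compact_continuous_image continuous_intros)
    then obtain b where b: "\<forall>x\<in>K. \<bar>Df x \<bullet> e\<bar> \<le> b"
      by (auto dest!: compact_imp_bounded simp: bounded_iff)
    have "\<bar>Df x \<bullet> e\<bar> \<le> max 0 b" for x
      using b zero by (cases "x \<in> K") (auto simp: max.coboundedI2)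
    then show thesis
      using that[of "max 0 b"] by simp
  qed
  obtain \<rho> where \<rho>: "\<And>x. x \<in> K \<Longrightarrow> norm x \<le> \<rho>"
    using compact_imp_bounded[OF assms(1)] by (auto simp: bounded_iff)
  \<comment> \<open>Any null sequence of step sizes in \<open>(0, 1]\<close> would do.\<close>
  define t where "t n = 1 / real (Suc n)" for n
  have t: "0 < t n" "t n \<le> 1" for n
    by (auto simp: t_def divide_simps)
  define q where "q n x = (f (t n *\<^sub>R e + x) - f x) / t n" for n x
  have line: "((\<lambda>s. f (s *\<^sub>R e + x)) has_derivative (\<lambda>h. h * (Df (s *\<^sub>R e + x) \<bullet> e))) (at s within A)" for s x A
  proof -
    have "((\<lambda>s. s *\<^sub>R e + x) has_derivative (\<lambda>h. h *\<^sub>R e)) (at s)"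
      by (auto intro!: derivative_eq_intros)
    from has_derivative_compose[OF this deriv] show ?thesis
      by (auto intro!: has_derivative_at_withinI simp: inner_commute)
  qed
  have q_eq: "\<exists>s\<in>{0<..<t n}. q n x = Df (s *\<^sub>R e + x) \<bullet> e" for n x
    using mvt_simple[OF t(1)[of n], of "\<lambda>s. f (s *\<^sub>R e + x)" "\<lambda>s h. h * (Df (s *\<^sub>R e + x) \<bullet> e)"] line t(1)[of n]
    by (auto simp: q_def divide_simps mult.commute)
  have q_tendsto: "(\<lambda>n. q n x) \<longlonglongrightarrow> Df x \<bullet> e" for x
  proof -
    have "((\<lambda>s. f (s *\<^sub>R e + x)) has_field_derivative (Df (0 *\<^sub>R e + x) \<bullet> e)) (at 0)"
      using line[of x 0 UNIV] unfolding has_field_derivative_def by (simp add: mult_commute_abs)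
    then have "((\<lambda>h. (f (h *\<^sub>R e + x) - f x) / h) \<longlongrightarrow> Df x \<bullet> e) (at 0)"
      by (simp add: DERIV_def)
    moreover have "filterlim t (at 0) sequentially"
      unfolding filterlim_at using t LIMSEQ_Suc[OF lim_1_over_n]
      by (auto simp: t_def[abs_def])
    ultimately show ?thesis
      unfolding q_def by (rule filterlim_compose)
  qed
  have "(\<lambda>n. LINT x|lborel. q n x) \<longlonglongrightarrow> (LINT x|lborel. Df x \<bullet> e)"
  proof (rule integral_dominated_convergence)
    show "integrable lborel (\<lambda>x. indicator (cball 0 (\<rho> + norm e)) x *\<^sub>R B)"
      by (rule borel_integrable_compact) auto
    show "AE x in lborel. norm (q n x) \<le> indicator (cball 0 (\<rho> + norm e)) x *\<^sub>R B" for n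
    proof (rule AE_I2)
      fix x
      obtain s where s: "0 < s" "s < t n" "q n x = Df (s *\<^sub>R e + x) \<bullet> e"
        using q_eq by force
      show "norm (q n x) \<le> indicator (cball 0 (\<rho> + norm e)) x *\<^sub>R B"
      proof (cases "s *\<^sub>R e + x \<in> K")
        case True
        have "norm x \<le> norm (s *\<^sub>R e + x) + norm (s *\<^sub>R e)"
          using norm_triangle_ineq4[of "s *\<^sub>R e + x" "s *\<^sub>R e"] by simp
        moreover have "norm (s *\<^sub>R e) \<le> 1 * norm e"
          unfolding norm_scaleR using s(1,2) t(2)[of n] by (intro mult_right_mono) auto
        ultimately have "norm x \<le> \<rho> + norm e"
          using \<rho>[OF True] by simp
        then show ?thesis
          using B s(3) by simp
      next
        case False
        then show ?thesis
          using s(3) zero B(1) by (simp add: indicator_def)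
      qed
    qed
    show "(\<lambda>x. Df x \<bullet> e) \<in> borel_measurable lborel"
      using cont by (auto intro!: borel_measurable_continuous_onI continuous_intros)
    show "q n \<in> borel_measurable lborel" for n
      unfolding q_def using t(1)[of n]
      by (auto intro!: borel_measurable_continuous_onI continuous_intros continuous_on_compose2[OF cont(1)])
  qed (use q_tendsto in auto)
  moreover have "(LINT x|lborel. q n x) = 0" for n
  proof -
    have int: "integrable lborel f"
      using assms(1) cont zero by (intro integrable_compact_support) auto
    have "f \<in> borel_measurable borel"
      using cont by (intro borel_measurable_continuous_onI)
    then have "integrable lborel (\<lambda>x. f (t n *\<^sub>R e + x))"
      using int integrable_distr_eq[of "(+) (t n *\<^sub>R e)" lborel borel f] lborel_distr_plus[of "t n *\<^sub>R e"]
      by simp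
    then show ?thesis
      using int lborel_integral_translate[OF cont(1)] by (simp add: q_def)
  qed
  ultimately show ?thesis
    by (simp add: LIMSEQ_const_iff)
qed

section \<open>Weak formulations of the equation and of stability\<close>

lemma C1_with_grad_powr:
  assumes "C1_with_grad \<Omega> f Df" "\<And>x. x \<in> \<Omega> \<Longrightarrow> f x > 0"
  shows "C1_with_grad \<Omega> (\<lambda>x. f x powr p) (\<lambda>x. (p * f x powr (p - 1)) *\<^sub>R Df x)"
  unfolding C1_with_grad_def
proof
  show "\<forall>x\<in>\<Omega>. GDERIV (\<lambda>x. f x powr p) x :> (p * f x powr (p - 1)) *\<^sub>R Df x"
  proof
    fix x assume "x \<in> \<Omega>"
    then show "GDERIV (\<lambda>x. f x powr p) x :> (p * f x powr (p - 1)) *\<^sub>R Df x"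
      using assms has_real_derivative_powr[of "f x" p]
      by (intro GDERIV_DERIV_compose[where g = "\<lambda>s. s powr p"]) (auto simp: C1_with_grad_def)
  qed
  show "continuous_on \<Omega> (\<lambda>x. (p * f x powr (p - 1)) *\<^sub>R Df x)"
    using assms(1) C1_with_grad_imp_continuous_on[OF assms(1)] assms(2)
    by (intro continuous_intros) (auto simp: C1_with_grad_def less_le)
qed

lemma Ck_on_1_imp_C1_with_grad:
  fixes f :: "real ^ 'n::finite \<Rightarrow> real"
  assumes "Ck_on 1 f S"
  shows "C1_with_grad S f (grad f)"
  unfolding C1_with_grad_def
proof
  have f: "f differentiable (at x)" if "x \<in> S" for x
    using assms that by simp
  have cont: "continuous_on S (partial_deriv i f)" for i
    using assms by simp
  show "\<forall>x\<in>S. GDERIV f x :> grad f x"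
  proof
    fix x assume "x \<in> S"
    let ?D = "frechet_derivative f (at x)"
    have D: "(f has_derivative ?D) (at x)"
      using f[OF \<open>x \<in> S\<close>] by (simp add: frechet_derivative_works)
    have "?D h = h \<bullet> grad f x" for h
    proof -
      have "?D h = ?D (\<Sum>i\<in>UNIV. h $ i *\<^sub>R axis i 1)"
        by (simp add: basis_expansion scalar_mult_eq_scaleR[symmetric])
      also have "\<dots> = (\<Sum>i\<in>UNIV. h $ i * ?D (axis i 1))"
        using has_derivative_linear[OF D] by (simp add: linear_sum linear_scale)
      also have "\<dots> = h \<bullet> grad f x"
        by (simp add: inner_vec_def grad_def partial_deriv_def)
      finally show ?thesis .
    qed
    then have "?D = (\<lambda>h. h \<bullet> grad f x)"
      by blast
    then show "GDERIV f x :> grad f x"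
      using D by (simp add: gderiv_def)
  qed
  show "continuous_on S (grad f)"
    unfolding grad_def using cont by (intro continuous_on_vec_lambda) (simp add: eta_contract_eq)
qed

lemma positive_solutionD:
  fixes v :: "real ^ 'n::finite \<Rightarrow> real"
  assumes "positive_solution \<Omega> v"
  shows "C1_with_grad \<Omega> v (grad v)"
    and "C1_with_grad \<Omega> (partial_deriv i v) (grad (partial_deriv i v))"
    and "\<And>x. x \<in> \<Omega> \<Longrightarrow> v x > 0"
    and "\<And>x. x \<in> \<Omega> \<Longrightarrow> (\<Sum>i\<in>UNIV. partial_deriv i (partial_deriv i v) x) = 1 / v x"
proof -
  have "Ck_on 1 v \<Omega>" "Ck_on (Suc 1) v \<Omega>"
    using assms unfolding positive_solution_def smooth_on_def by blast+
  then have "Ck_on 1 (partial_deriv i v) \<Omega>"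
    unfolding Ck_on.simps(2) by blast
  with \<open>Ck_on 1 v \<Omega>\<close> show "C1_with_grad \<Omega> v (grad v)"
    "C1_with_grad \<Omega> (partial_deriv i v) (grad (partial_deriv i v))"
    by (auto intro!: Ck_on_1_imp_C1_with_grad simp del: One_nat_def Ck_on.simps)
qed (use assms in \<open>auto simp: positive_solution_def laplacian_def\<close>)

text \<open>
  Each component \<open>partial_deriv i v * g\<close> is compactly supported, so the integral of its \<open>i\<close>-th
  derivative vanishes; these derivatives sum up to the integrand.
\<close>

lemma positive_solution_weak:
  fixes v :: "real ^ 'n::finite \<Rightarrow> real"
  assumes "open \<Omega>" "compact K" "K \<subseteq> \<Omega>" "positive_solution \<Omega> v" "C1_supported K g Dg"
  shows "(LINT x|lborel. g x / v x + grad v x \<bullet> Dg x) = 0"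
proof -
  note v = positive_solutionD[OF assms(4)]
  let ?F = "\<lambda>i x. partial_deriv i v x * g x"
  let ?DF = "\<lambda>i x. partial_deriv i v x *\<^sub>R Dg x + g x *\<^sub>R grad (partial_deriv i v) x"
  have F: "C1_supported K (?F i) (?DF i)" for i
    by (rule C1_supported_mult[OF assms(1-3) v(2) assms(5)])
  have "(LINT x|lborel. (\<Sum>i\<in>UNIV. ?DF i x \<bullet> axis i 1)) = (\<Sum>i\<in>UNIV. LINT x|lborel. ?DF i x \<bullet> axis i 1)"
  proof (intro Bochner_Integration.integral_sum integrable_compact_support[OF assms(2)])
    fix i
    show "continuous_on K (\<lambda>x. ?DF i x \<bullet> axis i 1)"
      by (rule continuous_on_inner[OF C1_supported_continuous(2)[OF F] continuous_on_const])
  next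
    fix i x assume "x \<notin> K"
    then show "?DF i x \<bullet> axis i 1 = 0"
      using F[of i] unfolding C1_supported_def by simp
  qed
  also have "\<dots> = 0"
    using integral_grad_eq_0[OF assms(2) F] by simp
  also have "(\<lambda>x. \<Sum>i\<in>UNIV. ?DF i x \<bullet> axis i 1) = (\<lambda>x. g x / v x + grad v x \<bullet> Dg x)"
  proof
    fix x
    show "(\<Sum>i\<in>UNIV. ?DF i x \<bullet> axis i 1) = g x / v x + grad v x \<bullet> Dg x"
    proof (cases "x \<in> \<Omega>")
      case True
      have "(\<Sum>i\<in>UNIV. ?DF i x \<bullet> axis i 1)
          = (\<Sum>i\<in>UNIV. grad v x $ i * Dg x $ i) + g x * (\<Sum>i\<in>UNIV. partial_deriv i (partial_deriv i v) x)"
        by (simp add: inner_axis grad_def sum.distrib sum_distrib_left)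
      then show ?thesis
        using v(4)[OF True] by (simp add: inner_vec_def)
    next
      case False
      then have "g x = 0" "Dg x = 0"
        using assms(3,5) by (auto simp: C1_supported_def)
      then show ?thesis
        by simp
    qed
  qed
  finally show ?thesis .
qed

lemma C1_supported_grad:
  fixes f :: "real ^ 'n::finite \<Rightarrow> real"
  assumes "C1_supported K f Df"
  shows "grad f x = Df x" "partial_deriv i f x = Df x $ i"
proof -
  have "(f has_derivative (\<lambda>h. h \<bullet> Df x)) (at x)" for x
    using assms by (auto simp: C1_supported_def C1_with_grad_def gderiv_def)
  from frechet_derivative_at[OF this] have "frechet_derivative f (at x) = (\<lambda>h. h \<bullet> Df x)" for x
    by simp
  then show *: "partial_deriv i f x = Df x $ i" for i
    by (simp add: partial_deriv_def inner_axis')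
  show "grad f x = Df x"
    by (simp add: grad_def * vec_eq_iff)
qed

lemma C1_supported_imp_test_function:
  fixes f :: "real ^ 'n::finite \<Rightarrow> real"
  assumes "compact K" "K \<subseteq> \<Omega>" "C1_supported K f Df"
  shows "test_function \<Omega> f"
proof -
  have "closure {x. f x \<noteq> 0} \<subseteq> K"
    using assms by (intro closure_minimal compact_imp_closed) (auto simp: C1_supported_def)
  moreover from this have "compact (closure {x. f x \<noteq> 0})"
    using assms(1) by (metis closed_Int_compact closed_closure inf.absorb1)
  moreover have "f differentiable (at x)" for x
    using assms(3) by (auto simp: C1_supported_def C1_with_grad_def gderiv_def differentiable_def)
  moreover have "continuous_on UNIV (partial_deriv i f)" for i
    using C1_supported_continuous(2)[OF assms(3)]
    by (auto simp: C1_supported_grad(2)[OF assms(3), abs_def] intro!: continuous_intros)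
  ultimately show ?thesis
    using assms(2) by (auto simp del: compact_closure simp add: test_function_def)
qed

lemma stable_on_whole_space:
  fixes v :: "real ^ 'n::finite \<Rightarrow> real"
  assumes "compact K" "K \<subseteq> \<Omega>" "stable_on \<Omega> v" "C1_supported K f Df"
  shows "(LINT x|lborel. (f x)\<^sup>2 / (v x)\<^sup>2) \<le> (LINT x|lborel. (norm (Df x))\<^sup>2)"
proof -
  have "f x = 0" "Df x = 0" if "x \<notin> \<Omega>" for x
    using assms(2,4) that by (auto simp: C1_supported_def)
  then have "(LINT x:\<Omega>|lborel. (f x)\<^sup>2 / (v x)\<^sup>2) = (LINT x|lborel. (f x)\<^sup>2 / (v x)\<^sup>2)"
    "(LINT x:\<Omega>|lborel. (norm (grad f x))\<^sup>2) = (LINT x|lborel. (norm (Df x))\<^sup>2)"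
    unfolding set_lebesgue_integral_def C1_supported_grad(1)[OF assms(4)]
    by (auto intro!: Bochner_Integration.integral_cong simp: indicator_def)
  then show ?thesis
    using assms(3) C1_supported_imp_test_function[OF assms(1,2,4)] by (auto simp: stable_on_def)
qed

section \<open>Uniform bounds for a negative power of a stable solution\<close>

text \<open>
  Put \<open>A = v powr (-13/4) * \<eta> * grad v\<close> and \<open>B = v powr (-9/4) * grad \<eta>\<close>, and let \<open>IX\<close> be the integral on
  the left.  With the test function \<open>v powr (-9/4) * \<eta>\<close>, stability bounds \<open>IX\<close> by the integral of
  \<open>\<bar>B - 9/4 * A\<bar>\<^sup>2\<close>, and with \<open>v powr (-11/2) * \<eta>\<^sup>2\<close> the equation expresses the integral of \<open>\<bar>A\<bar>\<^sup>2\<close> through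
  \<open>IX\<close> and the mixed term.  Eliminating \<open>\<bar>A\<bar>\<^sup>2\<close> leaves \<open>IX\<close> on the right with the factor
  \<open>(9/4)\<^sup>2 / (11/2) = 81/88 < 1\<close>, which can be absorbed if the mixed term is estimated well enough.
\<close>

lemma stable_energy_estimate:
  fixes v :: "real ^ 'n::finite \<Rightarrow> real"
  assumes "open \<Omega>" "compact K" "K \<subseteq> \<Omega>" "positive_solution \<Omega> v" "stable_on \<Omega> v"
    and \<eta>: "C1_supported K \<eta> D\<eta>"
  shows "(LINT x|lborel. v x powr (-13/2) * (\<eta> x)\<^sup>2) \<le> 400 * (LINT x|lborel. v x powr (-9/2) * (norm (D\<eta> x))\<^sup>2)"
proof -
  note v = positive_solutionD[OF assms(4)]
  have zero: "\<eta> x = 0" "D\<eta> x = 0" if "x \<notin> K" for x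
    using \<eta> that by (auto simp: C1_supported_def)
  have cont: "continuous_on K v" "continuous_on K (grad v)" "continuous_on K \<eta>" "continuous_on K D\<eta>"
    using v(1) C1_with_grad_imp_continuous_on[OF v(1)] C1_supported_continuous[OF \<eta>] assms(3)
    by (auto simp: C1_with_grad_def intro: continuous_on_subset)
  have nz: "\<forall>x\<in>K. v x \<noteq> 0"
    using v(3) assms(3) by force
  define A where "A x = (v x powr (-13/4) * \<eta> x) *\<^sub>R grad v x" for x
  define B where "B x = v x powr (-9/4) *\<^sub>R D\<eta> x" for x
  define X where "X x = v x powr (-13/2) * (\<eta> x)\<^sup>2" for x
  have contA: "continuous_on K A" and contB: "continuous_on K B"
    unfolding A_def[abs_def] B_def[abs_def] using cont nz by (auto intro!: continuous_intros)
  have AB0: "A x = 0" "B x = 0" if "x \<notin> K" for x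
    using zero that by (auto simp: A_def B_def)
  have int: "integrable lborel X" "integrable lborel (\<lambda>x. A x \<bullet> A x)"
    "integrable lborel (\<lambda>x. A x \<bullet> B x)" "integrable lborel (\<lambda>x. B x \<bullet> B x)"
    using contA contB cont nz AB0 zero unfolding X_def[abs_def]
    by (auto intro!: integrable_compact_support[OF assms(2)] continuous_intros)
  define IX where "IX = (LINT x|lborel. X x)"
  define IA where "IA = (LINT x|lborel. A x \<bullet> A x)"
  define IAB where "IAB = (LINT x|lborel. A x \<bullet> B x)"
  define IB where "IB = (LINT x|lborel. B x \<bullet> B x)"
  have pw: "v x powr p * v x powr q = v x powr (p + q)" for x p q
    by (simp add: powr_add)
  have sq: "(v x powr p)\<^sup>2 = v x powr (2 * p)" for x p
    by (simp add: power2_eq_square powr_add[symmetric])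
  have inv: "v x powr p / v x = v x powr (p - 1)" if "x \<in> \<Omega>" for x p
    using v(3)[OF that] by (simp add: powr_diff)
  have C1_powr: "C1_with_grad \<Omega> (\<lambda>x. v x powr p) (\<lambda>x. (p * v x powr (p - 1)) *\<^sub>R grad v x)" for p
    using v(1,3) by (rule C1_with_grad_powr)
  have stab: "IX \<le> 81/16 * IA - 9/2 * IAB + IB"
  proof -
    let ?\<zeta> = "\<lambda>x. v x powr (-9/4) * \<eta> x"
    let ?D\<zeta> = "\<lambda>x. v x powr (-9/4) *\<^sub>R D\<eta> x + \<eta> x *\<^sub>R ((-9/4 * v x powr (-9/4 - 1)) *\<^sub>R grad v x)"
    have "C1_supported K ?\<zeta> ?D\<zeta>"
      by (rule C1_supported_mult[OF assms(1-3) C1_powr \<eta>])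
    from stable_on_whole_space[OF assms(2,3,5) this]
    have "(LINT x|lborel. (?\<zeta> x)\<^sup>2 / (v x)\<^sup>2) \<le> (LINT x|lborel. (norm (?D\<zeta> x))\<^sup>2)" .
    also have "(\<lambda>x. (?\<zeta> x)\<^sup>2 / (v x)\<^sup>2) = X"
    proof
      fix x
      show "(?\<zeta> x)\<^sup>2 / (v x)\<^sup>2 = X x"
      proof (cases "x \<in> K")
        case True
        then have "x \<in> \<Omega>"
          using assms(3) by auto
        have "(v x powr (-9/4))\<^sup>2 / (v x)\<^sup>2 = v x powr (-9/2) / v x / v x"
          by (simp add: sq power2_eq_square[of "v x"])
        also have "\<dots> = v x powr (-13/2)"
          using inv[OF \<open>x \<in> \<Omega>\<close>] by (simp del: divide_divide_eq_left)
        finally have "(v x powr (-9/4))\<^sup>2 / (v x)\<^sup>2 * (\<eta> x)\<^sup>2 = v x powr (-13/2) * (\<eta> x)\<^sup>2"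
          by simp
        then show ?thesis
          by (simp add: X_def power_mult_distrib)
      qed (simp add: X_def zero)
    qed
    also have "(\<lambda>x. (norm (?D\<zeta> x))\<^sup>2) = (\<lambda>x. 81/16 * (A x \<bullet> A x) - 9/2 * (A x \<bullet> B x) + B x \<bullet> B x)"
    proof
      fix x
      have "?D\<zeta> x = B x - (9/4) *\<^sub>R A x"
        by (simp add: A_def B_def)
      moreover have "(norm (B x - (9/4) *\<^sub>R A x))\<^sup>2 = 81/16 * (A x \<bullet> A x) - 9/2 * (A x \<bullet> B x) + B x \<bullet> B x"
        unfolding power2_norm_eq_inner inner_diff_left inner_diff_right inner_scaleR_left inner_scaleR_right
          inner_commute[of "B x" "A x"]
        by (simp add: algebra_simps)
      ultimately show "(norm (?D\<zeta> x))\<^sup>2 = 81/16 * (A x \<bullet> A x) - 9/2 * (A x \<bullet> B x) + B x \<bullet> B x"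
        by (simp only:)
    qed
    finally show ?thesis
      using int by (simp add: IX_def IA_def IAB_def IB_def)
  qed
  have weak: "IX - 11/2 * IA + 2 * IAB = 0"
  proof -
    let ?g = "\<lambda>x. v x powr (-11/2) * (\<eta> x * \<eta> x)"
    let ?Dg = "\<lambda>x. v x powr (-11/2) *\<^sub>R (\<eta> x *\<^sub>R D\<eta> x + \<eta> x *\<^sub>R D\<eta> x)
                    + (\<eta> x * \<eta> x) *\<^sub>R ((-11/2 * v x powr (-11/2 - 1)) *\<^sub>R grad v x)"
    have "C1_supported K (\<lambda>x. \<eta> x * \<eta> x) (\<lambda>x. \<eta> x *\<^sub>R D\<eta> x + \<eta> x *\<^sub>R D\<eta> x)"
      using \<eta> assms(2) by (intro C1_supported_mult[where \<Omega> = UNIV]) (auto simp: C1_supported_def)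
    then have "C1_supported K ?g ?Dg"
      by (rule C1_supported_mult[OF assms(1-3) C1_powr])
    from positive_solution_weak[OF assms(1-4) this]
    have "(LINT x|lborel. ?g x / v x + grad v x \<bullet> ?Dg x) = 0" .
    also have "(\<lambda>x. ?g x / v x + grad v x \<bullet> ?Dg x) = (\<lambda>x. X x - 11/2 * (A x \<bullet> A x) + 2 * (A x \<bullet> B x))"
    proof
      fix x
      show "?g x / v x + grad v x \<bullet> ?Dg x = X x - 11/2 * (A x \<bullet> A x) + 2 * (A x \<bullet> B x)"
      proof (cases "x \<in> K")
        case True
        then have "v x powr (-11/2) / v x = v x powr (-13/2)"
          using assms(3) inv[of x] by auto
        then have "?g x / v x = X x"
          unfolding X_def power2_eq_square by (metis times_divide_eq_left)
        moreover have "A x \<bullet> A x = v x powr (-13/2) * (\<eta> x)\<^sup>2 * (grad v x \<bullet> grad v x)"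
          using pw[of x "-13/4" "-13/4"] by (simp add: A_def power2_eq_square mult_ac)
        moreover have "A x \<bullet> B x = v x powr (-11/2) * \<eta> x * (grad v x \<bullet> D\<eta> x)"
          using pw[of x "-13/4" "-9/4"] by (simp add: A_def B_def mult_ac)
        moreover have "grad v x \<bullet> ?Dg x
            = 2 * (v x powr (-11/2) * \<eta> x * (grad v x \<bullet> D\<eta> x))
              - 11/2 * (v x powr (-13/2) * (\<eta> x)\<^sup>2 * (grad v x \<bullet> grad v x))"
          unfolding inner_add_right inner_scaleR_right by (simp add: power2_eq_square algebra_simps)
        ultimately show ?thesis
          by (simp only:)
      qed (simp add: X_def AB0 zero)
    qed
    finally show ?thesis
      using int by (simp add: IX_def IA_def IAB_def)
  qed
  \<comment> \<open>The weight \<open>1/4\<close> makes the \<open>IX\<close> contribution of the mixed term smaller than the remaining \<open>7/88\<close>.\<close>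
  have young: "0 \<le> IA / 16 + IAB / 2 + IB"
  proof -
    have "0 \<le> (LINT x|lborel. ((1/4) *\<^sub>R A x + B x) \<bullet> ((1/4) *\<^sub>R A x + B x))"
      by (intro integral_nonneg_AE) auto
    also have "(\<lambda>x. ((1/4) *\<^sub>R A x + B x) \<bullet> ((1/4) *\<^sub>R A x + B x))
        = (\<lambda>x. (A x \<bullet> A x) / 16 + (A x \<bullet> B x) / 2 + B x \<bullet> B x)"
      by (auto simp: inner_add_left inner_add_right inner_commute)
    finally show ?thesis
      using int by (simp add: IA_def IAB_def IB_def)
  qed
  have "0 \<le> IX" "0 \<le> IB"
    unfolding IX_def IB_def X_def by (auto intro!: integral_nonneg_AE)
  then have "IX \<le> 400 * IB"
    using stab weak young by linarith
  also have "IB = (LINT x|lborel. v x powr (-9/2) * (norm (D\<eta> x))\<^sup>2)"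
    unfolding IB_def B_def using pw[of _ "-9/4" "-9/4"]
    by (intro Bochner_Integration.integral_cong) (auto simp: power2_norm_eq_inner mult.assoc[symmetric])
  finally show ?thesis
    by (simp add: IX_def X_def)
qed

text \<open>
  The cutoffs are powers of this truncated paraboloid.  The gradient of such a power is a lower power times
  \<open>x - x0\<close>, which serves twice: in the energy estimate, and for the radial derivative of weighted means.
\<close>

definition bump :: "'a::euclidean_space \<Rightarrow> real \<Rightarrow> 'a \<Rightarrow> real" where
  "bump x0 R x = max 0 (R\<^sup>2 - (norm (x - x0))\<^sup>2)"

lemma bump_nonneg [simp]: "0 \<le> bump x0 R x"
  by (simp add: bump_def)

lemma bump_le: "bump x0 R x \<le> R\<^sup>2"
  by (simp add: bump_def)

lemma bump_eq_0: "0 \<le> R \<Longrightarrow> x \<notin> cball x0 R \<Longrightarrow> bump x0 R x = 0"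
  by (auto simp: bump_def dist_norm norm_minus_commute max_def)

lemma continuous_on_bump [continuous_intros]: "continuous_on A (bump x0 R)"
  unfolding bump_def[abs_def] by (intro continuous_intros)

lemma bump_scale:
  "s > 0 \<Longrightarrow> bump x0 s (x0 + s *\<^sub>R y) = s\<^sup>2 * bump 0 1 y"
  by (simp add: bump_def power_mult_distrib max_def algebra_simps)

lemma has_real_derivative_pos_part_power:
  "((\<lambda>s::real. (max 0 s) ^ Suc (Suc k)) has_real_derivative real (Suc (Suc k)) * (max 0 s) ^ Suc k) (at s)"
proof -
  consider "s < 0" | "s = 0" | "s > 0"
    by linarith
  then show ?thesis
  proof cases
    case 1
    have "((\<lambda>s::real. (max 0 s) ^ Suc (Suc k)) has_real_derivative 0) (at s)"
      using 1 by (intro has_field_derivative_transform_within_open[OF DERIV_const[of 0], where S = "{..<0}"]) auto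
    then show ?thesis
      using 1 by simp
  next
    case 3
    have "((\<lambda>s::real. s ^ Suc (Suc k)) has_real_derivative real (Suc (Suc k)) * s ^ Suc k) (at s)"
      using DERIV_pow[of "Suc (Suc k)" s UNIV] by simp
    then have "((\<lambda>s::real. (max 0 s) ^ Suc (Suc k)) has_real_derivative real (Suc (Suc k)) * s ^ Suc k) (at s)"
      using 3 by (rule_tac has_field_derivative_transform_within_open[where S = "{0<..}"]) auto
    then show ?thesis
      using 3 by simp
  next
    case 2
    have "((\<lambda>h::real. (max 0 h) ^ Suc (Suc k) / h) \<longlongrightarrow> 0) (at 0)"
    proof (rule Lim_null_comparison)
      show "\<forall>\<^sub>F h in at (0::real). norm ((max 0 h) ^ Suc (Suc k) / h) \<le> \<bar>h\<bar> ^ Suc k"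
      proof (intro always_eventually allI)
        fix h :: real
        have "norm ((max 0 h) ^ Suc (Suc k) / h) = (max 0 h) ^ Suc k * (max 0 h / \<bar>h\<bar>)"
          by (simp add: abs_mult power_abs)
        also have "\<dots> \<le> \<bar>h\<bar> ^ Suc k * 1"
          by (intro mult_mono power_mono) (auto simp: divide_le_eq_1)
        finally show "norm ((max 0 h) ^ Suc (Suc k) / h) \<le> \<bar>h\<bar> ^ Suc k"
          by simp
      qed
      show "((\<lambda>h::real. \<bar>h\<bar> ^ Suc k) \<longlongrightarrow> 0) (at 0)"
        by (auto intro!: tendsto_eq_intros)
    qed
    then show ?thesis
      using 2 by (simp add: DERIV_def)
  qed
qed

lemma C1_supported_bump_power:
  assumes "R \<ge> 0"
  shows "C1_supported (cball x0 R) (\<lambda>x. bump x0 R x ^ Suc (Suc k))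
           (\<lambda>x. - (2 * real (Suc (Suc k)) * bump x0 R x ^ Suc k) *\<^sub>R (x - x0))"
proof -
  have "GDERIV (\<lambda>x. R\<^sup>2 - (norm (x - x0))\<^sup>2) x :> - (2 *\<^sub>R (x - x0))" for x
    unfolding gderiv_def power2_norm_eq_inner
    by (auto intro!: derivative_eq_intros simp: inner_commute)
  from GDERIV_DERIV_compose[OF this has_real_derivative_pos_part_power]
  have "GDERIV (\<lambda>x. bump x0 R x ^ Suc (Suc k)) x
      :> (real (Suc (Suc k)) * bump x0 R x ^ Suc k) *\<^sub>R (- (2 *\<^sub>R (x - x0)))" for x
    unfolding bump_def .
  then have "GDERIV (\<lambda>x. bump x0 R x ^ Suc (Suc k)) x
      :> - (2 * real (Suc (Suc k)) * bump x0 R x ^ Suc k) *\<^sub>R (x - x0)" for x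
    by (rule GDERIV_subst) (simp add: mult_ac)
  moreover have "continuous_on UNIV (\<lambda>x. - (2 * real (Suc (Suc k)) * bump x0 R x ^ Suc k) *\<^sub>R (x - x0))"
    by (intro continuous_intros)
  ultimately show ?thesis
    using bump_eq_0[OF assms] by (auto simp: C1_supported_def C1_with_grad_def)
qed

text \<open>
  In terms of \<open>b / t\<close> this bounds a power by a small multiple of a higher power plus a constant.  The
  exponents of \<open>b\<close> are large enough to leave the nonnegative power \<open>b powr (3/2)\<close> in the remainder.
\<close>

lemma young_powr:
  fixes b t \<kappa> B :: real
  assumes "0 < t" "0 \<le> b" "b \<le> B" "0 < \<kappa>"
  shows "t powr (-9/2) * b ^ 6 \<le> \<kappa>\<^sup>2 * (t powr (-13/2) * b ^ 8) + \<kappa> powr (-9/2) * B powr (3/2)"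
proof (cases "t \<le> \<kappa> * b")
  case True
  have "t powr (-9/2) = t powr (-13/2 + 2)"
    by simp
  also have "\<dots> = t powr (-13/2) * t\<^sup>2"
    unfolding powr_add using assms(1) by simp
  also have "\<dots> \<le> t powr (-13/2) * (\<kappa> * b)\<^sup>2"
    using True assms(1) by (intro mult_left_mono power_mono) auto
  finally have "t powr (-9/2) * b ^ 6 \<le> t powr (-13/2) * (\<kappa> * b)\<^sup>2 * b ^ 6"
    by (intro mult_right_mono) auto
  also have "\<dots> = \<kappa>\<^sup>2 * (t powr (-13/2) * b ^ 8)"
    by (simp add: power_mult_distrib algebra_simps flip: power_add)
  finally show ?thesis
    by (simp add: add_increasing2)
next
  case False
  have "t powr (-9/2) * b ^ 6 \<le> \<kappa> powr (-9/2) * B powr (3/2)"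
  proof (cases "b = 0")
    case b: False
    then have "t powr (-9/2) \<le> (\<kappa> * b) powr (-9/2)"
      using False assms by (intro powr_mono2') auto
    then have "t powr (-9/2) * b ^ 6 \<le> (\<kappa> * b) powr (-9/2) * b powr 6"
      using assms b by (simp add: mult_right_mono)
    also have "\<dots> = \<kappa> powr (-9/2) * (b powr (-9/2) * b powr 6)"
      using assms b by (simp add: powr_mult)
    also have "b powr (-9/2) * b powr 6 = b powr (3/2)"
      by (simp add: powr_add[symmetric])
    also have "\<kappa> powr (-9/2) * b powr (3/2) \<le> \<kappa> powr (-9/2) * B powr (3/2)"
      using assms by (intro mult_left_mono powr_mono2) auto
    finally show ?thesis .
  qed auto
  then show ?thesis
    using assms(2) by (simp add: add_increasing)
qed

text \<open>
  For the cutoff \<open>\<eta> = bump ^ 4\<close>, the right-hand side of the energy estimate is a multiple of the integral of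
  \<open>v powr (-9/2) * bump ^ 6\<close>, a lower negative power of \<open>v\<close>.  It is absorbed by \<open>young_powr\<close>, so that
  only a constant depending on the ball is left.
\<close>

lemma stable_inverse_power_bound:
  fixes \<Omega> :: "(real ^ 'n::finite) set"
  assumes "open \<Omega>" "cball x0 R \<subseteq> \<Omega>" "R > 0"
  obtains M where "M \<ge> 0"
    "\<And>v. positive_solution \<Omega> v \<Longrightarrow> stable_on \<Omega> v \<Longrightarrow>
       (LINT x|lborel. v x powr (-13/2) * bump x0 R x ^ 8) \<le> M"
proof -
  \<comment> \<open>The choice of \<open>\<kappa>\<close> makes \<open>400 * 64 * R\<^sup>2 * \<kappa>\<^sup>2\<close>, the factor of the absorbed term, less than \<open>1/2\<close>.\<close>
  define \<kappa> where "\<kappa> = 1 / (250 * R)"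
  define L where "L = 25600 * R\<^sup>2 * (\<kappa> powr (-9/2) * (R\<^sup>2) powr (3/2))"
  define J where "J = (LINT x|lborel. indicator (cball x0 R) x *\<^sub>R L)"
  have "L \<ge> 0"
    by (simp add: L_def)
  have J: "J \<ge> 0"
    unfolding J_def using \<open>L \<ge> 0\<close> by (auto intro!: integral_nonneg_AE)
  have int_L: "integrable lborel (\<lambda>x. indicator (cball x0 R) x *\<^sub>R L)"
    by (rule borel_integrable_compact) auto
  show thesis
  proof (rule that[of "2 * J"])
    fix v :: "real ^ 'n \<Rightarrow> real"
    assume v: "positive_solution \<Omega> v" "stable_on \<Omega> v"
    let ?K = "cball x0 R"
    let ?b = "bump x0 R"
    let ?D = "\<lambda>x. - (8 * ?b x ^ 3) *\<^sub>R (x - x0)"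
    have \<eta>: "C1_supported ?K (\<lambda>x. ?b x ^ 4) ?D"
      using C1_supported_bump_power[of R x0 2] assms(3) by (simp add: numeral_eq_Suc)
    note pos = positive_solutionD(3)[OF v(1)]
    have cont: "continuous_on ?K v" "\<forall>x\<in>?K. v x \<noteq> 0"
      using C1_with_grad_imp_continuous_on[OF positive_solutionD(1)[OF v(1)]] assms(2) pos
      by (auto intro: continuous_on_subset) force
    have b0: "?b x = 0" if "x \<notin> ?K" for x
      using bump_eq_0[of R x x0] that assms(3) by simp
    let ?X = "\<lambda>x. v x powr (-13/2) * ?b x ^ 8"
    let ?W = "\<lambda>x. v x powr (-9/2) * (norm (?D x))\<^sup>2"
    have int: "integrable lborel ?X" "integrable lborel ?W"
      using cont b0 by (auto intro!: integrable_compact_support[OF compact_cball] continuous_intros)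
    have pw: "400 * ?W x \<le> ?X x / 2 + indicator ?K x *\<^sub>R L" for x
    proof (cases "x \<in> ?K")
      case True
      then have "norm (x - x0) \<le> R"
        by (simp add: dist_norm norm_minus_commute)
      then have "(norm (x - x0))\<^sup>2 \<le> R\<^sup>2"
        by (intro power_mono) auto
      have "(norm (?D x))\<^sup>2 = 64 * ?b x ^ 6 * (norm (x - x0))\<^sup>2"
        by (simp add: power_mult_distrib flip: power_mult)
      then have "400 * ?W x = 25600 * (v x powr (-9/2) * ?b x ^ 6) * (norm (x - x0))\<^sup>2"
        by (simp only: mult_ac)
      also have "\<dots> \<le> 25600 * (v x powr (-9/2) * ?b x ^ 6) * R\<^sup>2"
        using \<open>(norm (x - x0))\<^sup>2 \<le> R\<^sup>2\<close> by (intro mult_left_mono) auto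
      also have "\<dots> = 25600 * R\<^sup>2 * (v x powr (-9/2) * ?b x ^ 6)"
        by simp
      also have "\<dots> \<le> 25600 * R\<^sup>2 * (\<kappa>\<^sup>2 * ?X x + \<kappa> powr (-9/2) * (R\<^sup>2) powr (3/2))"
      proof (intro mult_left_mono young_powr)
        show "0 < v x"
          using pos True assms(2) by blast
      qed (use assms(3) bump_le in \<open>auto simp: \<kappa>_def\<close>)
      also have "\<dots> = (25600 / 62500) * ?X x + L"
        using assms(3) by (simp add: L_def \<kappa>_def field_simps power2_eq_square)
      also have "\<dots> \<le> ?X x / 2 + L"
        by simp
      finally show ?thesis
        using True by simp
    qed (simp add: b0)
    have "(LINT x|lborel. (?b x ^ 4)\<^sup>2 * v x powr (-13/2)) \<le> 400 * (LINT x|lborel. ?W x)"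
      using stable_energy_estimate[OF assms(1) compact_cball assms(2) v \<eta>] by (simp add: mult.commute)
    moreover have "(\<lambda>x. (?b x ^ 4)\<^sup>2 * v x powr (-13/2)) = ?X"
      by (auto simp flip: power_mult)
    ultimately have "(LINT x|lborel. ?X x) \<le> (LINT x|lborel. 400 * ?W x)"
      by simp
    also have "\<dots> \<le> (LINT x|lborel. ?X x / 2 + indicator ?K x *\<^sub>R L)"
      using int int_L pw by (intro integral_mono) auto
    also have "\<dots> = (LINT x|lborel. ?X x) / 2 + J"
      using int int_L by (simp add: J_def)
    finally show "(LINT x|lborel. ?X x) \<le> 2 * J"
      by simp
  qed (use J in auto)
qed

section \<open>Growth of weighted means\<close>

lemma lborel_integral_dilate:
  fixes f :: "'a::euclidean_space \<Rightarrow> real"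
  assumes "continuous_on UNIV f" "s > 0"
  shows "s ^ DIM('a) * (LINT y|lborel. f (x0 + s *\<^sub>R y)) = (LINT x|lborel. f x)"
proof -
  have [measurable]: "f \<in> borel_measurable borel"
    using assms(1) by (rule borel_measurable_continuous_onI)
  have "(LINT x|lborel. f x) = (LINT x|density (distr lborel borel (\<lambda>x. x0 + s *\<^sub>R x)) (\<lambda>_. \<bar>s\<bar> ^ DIM('a)). f x)"
    using lborel_affine[of s x0] assms(2) by simp
  also have "\<dots> = (LINT x|distr lborel borel (\<lambda>x. x0 + s *\<^sub>R x). (\<bar>s\<bar> ^ DIM('a)) *\<^sub>R f x)"
    by (subst integral_density) auto
  also have "\<dots> = (LINT y|lborel. (\<bar>s\<bar> ^ DIM('a)) *\<^sub>R f (x0 + s *\<^sub>R y))"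
    by (subst integral_distr) auto
  finally show ?thesis
    using assms(2) by simp
qed

abbreviation unit_bump :: "'a::euclidean_space \<Rightarrow> real" where
  "unit_bump \<equiv> bump 0 1"

lemma unit_bump_le_1: "unit_bump x \<le> 1"
  using bump_le[of 0 1 x] by simp

lemma unit_bump_eq_0: "x \<notin> cball 0 1 \<Longrightarrow> unit_bump x = 0"
  by (rule bump_eq_0) auto

lemma integrable_mult_unit_bump:
  fixes F :: "'a::euclidean_space \<Rightarrow> real"
  assumes "continuous_on (cball 0 1) F" "k > 0"
  shows "integrable lborel (\<lambda>y. F y * unit_bump y ^ k)"
proof (rule integrable_compact_support[OF compact_cball])
  show "continuous_on (cball 0 1) (\<lambda>y. F y * unit_bump y ^ k)"
    using assms(1) by (intro continuous_intros)
  show "F y * unit_bump y ^ k = 0" if "y \<notin> cball 0 1" for y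
    using unit_bump_eq_0[OF that] assms(2) by simp
qed

lemma integral_unit_bump_pos: "0 < (LINT y|lborel. (unit_bump (y::'a::euclidean_space))\<^sup>2)"
proof -
  let ?B = "cball (0::'a) (1/2)"
  have "0 < measure lborel ?B * (1/2)"
    by (simp add: content_cball_pos[unfolded measure_def] measure_def content_cball_pos)
  also have "\<dots> = (LINT y|lborel. indicator ?B y *\<^sub>R (1/2::real))"
    by simp
  also have "\<dots> \<le> (LINT y|lborel. (unit_bump (y::'a))\<^sup>2)"
  proof (rule integral_mono)
    show "integrable lborel (\<lambda>y. indicator ?B y *\<^sub>R (1/2::real))"
      by (rule borel_integrable_compact) auto
    show "integrable lborel (\<lambda>y. (unit_bump (y::'a))\<^sup>2)"
      using unit_bump_eq_0
      by (intro integrable_compact_support[of "cball 0 1"] continuous_intros) auto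
    fix y :: 'a
    show "indicator ?B y *\<^sub>R (1/2::real) \<le> (unit_bump y)\<^sup>2"
    proof (cases "y \<in> ?B")
      case True
      then have "(norm y)\<^sup>2 \<le> (1/2)\<^sup>2"
        by (intro power_mono) auto
      then have "3/4 \<le> unit_bump y"
        by (simp add: bump_def power2_eq_square)
      then have "(3/4)\<^sup>2 \<le> (unit_bump y)\<^sup>2"
        by (intro power_mono) auto
      then show ?thesis
        using True by (simp add: power2_eq_square)
    qed simp
  qed
  finally show ?thesis .
qed

lemma mult_le_imp_mem_cball:
  fixes y :: "'a::real_normed_vector"
  assumes "0 \<le> s" "s * norm y \<le> R"
  shows "x0 + s *\<^sub>R y \<in> cball x0 R"
  using assms by (simp add: dist_norm)

text \<open>
  The weight times the position vector is a gradient: \<open>y * unit_bump\<^sup>2 = - grad (unit_bump ^ 3) / 6\<close>.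
  So an integration by parts turns the radial derivative of the mean of \<open>v\<close> into a mean of
  \<open>\<Delta> v = 1/v\<close>.
\<close>

lemma positive_solution_mean_deriv:
  fixes v :: "real ^ 'n::finite \<Rightarrow> real"
  assumes "open \<Omega>" "cball x0 R \<subseteq> \<Omega>" "0 < s" "s \<le> R" "positive_solution \<Omega> v"
  shows "(LINT y|lborel. (grad v (x0 + s *\<^sub>R y) \<bullet> y) * (unit_bump y)\<^sup>2)
       = s / 6 * (LINT y|lborel. (unit_bump y) ^ 3 / v (x0 + s *\<^sub>R y))"
proof -
  note v = positive_solutionD[OF assms(5)]
  let ?K = "cball x0 s"
  let ?b = "bump x0 s"
  have K: "?K \<subseteq> \<Omega>"
    using assms(2,4) by auto
  have b0: "?b x = 0" if "x \<notin> ?K" for x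
    using bump_eq_0[of s x x0] that assms(3) by simp
  have cont: "continuous_on \<Omega> v" "continuous_on \<Omega> (grad v)" "\<forall>x\<in>\<Omega>. v x \<noteq> 0"
    using v(1) C1_with_grad_imp_continuous_on[OF v(1)] v(3)
    by (auto simp: C1_with_grad_def less_le)
  let ?F = "\<lambda>x. (grad v x \<bullet> (x - x0)) * (?b x)\<^sup>2"
  let ?G = "\<lambda>x. (?b x) ^ 3 / v x"
  have contFG: "continuous_on UNIV ?F" "continuous_on UNIV ?G"
    by (rule continuous_on_zero_extension[OF assms(1) compact_cball K];
        use b0 cont in \<open>auto intro!: continuous_intros\<close>)+
  have int: "integrable lborel ?F" "integrable lborel ?G"
    using b0 contFG
    by (auto intro!: integrable_compact_support[of ?K] intro: continuous_on_subset)
  have "C1_supported ?K (\<lambda>x. ?b x ^ 3) (\<lambda>x. - (6 * (?b x)\<^sup>2) *\<^sub>R (x - x0))"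
    using C1_supported_bump_power[of s x0 1] assms(3) by (simp add: numeral_eq_Suc)
  from positive_solution_weak[OF assms(1) compact_cball K assms(5) this]
  have "0 = (LINT x|lborel. ?G x + grad v x \<bullet> (- (6 * (?b x)\<^sup>2) *\<^sub>R (x - x0)))" ..
  also have "\<dots> = (LINT x|lborel. ?G x - 6 * ?F x)"
    by (intro Bochner_Integration.integral_cong) auto
  also have "\<dots> = (LINT x|lborel. ?G x) - 6 * (LINT x|lborel. ?F x)"
    using int by simp
  finally have eq: "6 * (LINT x|lborel. ?F x) = (LINT x|lborel. ?G x)"
    by simp
  have "s ^ DIM(real ^ 'n) * (6 * (LINT y|lborel. ?F (x0 + s *\<^sub>R y)))
      = s ^ DIM(real ^ 'n) * (LINT y|lborel. ?G (x0 + s *\<^sub>R y))"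
    unfolding lborel_integral_dilate[OF contFG(2) assms(3)] mult.left_commute[of _ 6]
      lborel_integral_dilate[OF contFG(1) assms(3)] by (rule eq)
  then have "6 * (LINT y|lborel. ?F (x0 + s *\<^sub>R y)) = (LINT y|lborel. ?G (x0 + s *\<^sub>R y))"
    using assms(3) by simp
  also have "(\<lambda>y. ?F (x0 + s *\<^sub>R y)) = (\<lambda>y. s ^ 5 * ((grad v (x0 + s *\<^sub>R y) \<bullet> y) * (unit_bump y)\<^sup>2))"
    using assms(3) by (simp add: bump_scale power_mult_distrib fun_eq_iff eval_nat_numeral)
  also have "(\<lambda>y. ?G (x0 + s *\<^sub>R y)) = (\<lambda>y. s ^ 6 * ((unit_bump y) ^ 3 / v (x0 + s *\<^sub>R y)))"
    using assms(3) by (simp add: bump_scale power_mult_distrib fun_eq_iff flip: power_mult)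
  finally have "6 * (s ^ 5 * (LINT y|lborel. (grad v (x0 + s *\<^sub>R y) \<bullet> y) * (unit_bump y)\<^sup>2))
     = s ^ 6 * (LINT y|lborel. (unit_bump y) ^ 3 / v (x0 + s *\<^sub>R y))"
    by (simp only: integral_mult_right_zero)
  also have "s ^ 6 = s ^ 5 * s"
    by (simp flip: power_Suc2)
  finally show ?thesis
    using assms(3) by simp
qed

text \<open>
  The condition on \<open>r\<close> keeps the dilated cube \<open>x0 + s * [-1, 1]\<^sup>n\<close> inside the ball of radius \<open>R\<close>, so
  that the Leibniz rule, which is about integrals over boxes, applies to a continuous integrand.
\<close>

lemma has_derivative_mean:
  fixes v :: "real ^ 'n::finite \<Rightarrow> real"
  assumes "cball x0 R \<subseteq> \<Omega>" "0 < r" "real CARD('n) * r \<le> R" "C1_with_grad \<Omega> v Dv" "s \<in> {0..r}"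
  shows "((\<lambda>s. LINT y|lborel. v (x0 + s *\<^sub>R y) * (unit_bump y)\<^sup>2) has_real_derivative
           (LINT y|lborel. (Dv (x0 + s *\<^sub>R y) \<bullet> y) * (unit_bump y)\<^sup>2)) (at s within {0..r})"
proof -
  let ?Q = "cbox (-1) (1 :: real ^ 'n)"
  let ?f = "\<lambda>s y. v (x0 + s *\<^sub>R y) * (unit_bump y)\<^sup>2"
  let ?f' = "\<lambda>s y. (Dv (x0 + s *\<^sub>R y) \<bullet> y) * (unit_bump y)\<^sup>2"
  have in_\<Omega>: "x0 + t *\<^sub>R y \<in> \<Omega>" if "t \<in> {0..r}" "y \<in> ?Q" for t y
  proof -
    have "\<bar>y $ i\<bar> \<le> 1" for i
      using that(2) by (auto simp: mem_box_cart abs_le_iff minus_le_iff[of _ 1])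
    then have "(\<Sum>i\<in>UNIV. \<bar>y $ i\<bar>) \<le> real CARD('n)"
      using sum_bounded_above[of UNIV "\<lambda>i. \<bar>y $ i\<bar>" 1] by simp
    then have "norm y \<le> real CARD('n)"
      using norm_le_l1_cart[of y] by linarith
    then have "t * norm y \<le> r * real CARD('n)"
      using that(1) by (intro mult_mono) auto
    then show ?thesis
      using assms(1,3) mult_le_imp_mem_cball[of t y R x0] that(1) by (auto simp: mult.commute)
  qed
  have cont: "continuous_on \<Omega> v" "continuous_on \<Omega> Dv"
    using assms(4) C1_with_grad_imp_continuous_on by (auto simp: C1_with_grad_def)
  have cont_f: "continuous_on ?Q (?f t)" and cont_f': "continuous_on ?Q (?f' t)" if "t \<in> {0..r}" for t
    using in_\<Omega>[OF that]
    by (auto intro!: continuous_intros continuous_on_compose2[OF cont(1)] continuous_on_compose2[OF cont(2)])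
  have zero: "unit_bump y = 0" if "y \<notin> ?Q" for y :: "real ^ 'n"
  proof (rule unit_bump_eq_0)
    show "y \<notin> cball 0 1"
    proof
      assume "y \<in> cball 0 1"
      then have "\<bar>y $ i\<bar> \<le> 1" for i
        using component_le_norm_cart[of y i] by simp
      then have "y \<in> ?Q"
        by (auto simp: mem_box_cart abs_le_iff minus_le_iff[of _ 1])
      with that show False ..
    qed
  qed
  have to_HK: "integral ?Q g = (LINT y|lborel. g y)"
    if "continuous_on ?Q g" "\<And>y. y \<notin> ?Q \<Longrightarrow> g y = 0" for g :: "real ^ 'n \<Rightarrow> real"
  proof -
    have "integral ?Q g = integral UNIV (\<lambda>y. if y \<in> ?Q then g y else 0)"
      by (simp add: integral_restrict_UNIV)
    also have "(\<lambda>y. if y \<in> ?Q then g y else 0) = g"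
      using that(2) by auto
    also have "integral UNIV g = (LINT y|lborel. g y)"
      using that by (intro integral_lborel integrable_compact_support[of ?Q]) auto
    finally show ?thesis .
  qed
  have "((\<lambda>s. integral ?Q (?f s)) has_real_derivative integral ?Q (?f' s)) (at s within {0..r})"
  proof (rule leibniz_rule_field_derivative)
    fix t y assume ty: "t \<in> {0..r}" "y \<in> ?Q"
    have "(v has_derivative (\<lambda>h. h \<bullet> Dv (x0 + t *\<^sub>R y))) (at (x0 + t *\<^sub>R y))"
      using in_\<Omega>[OF ty] assms(4) by (auto simp: C1_with_grad_def gderiv_def)
    moreover have "((\<lambda>t. x0 + t *\<^sub>R y) has_derivative (\<lambda>h. h *\<^sub>R y)) (at t within {0..r})"
      by (auto intro!: derivative_eq_intros)
    ultimately have "((\<lambda>t. v (x0 + t *\<^sub>R y)) has_derivative (\<lambda>h. (h *\<^sub>R y) \<bullet> Dv (x0 + t *\<^sub>R y))) (at t within {0..r})"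
      by (rule has_derivative_compose[rotated])
    then have "((\<lambda>t. v (x0 + t *\<^sub>R y)) has_real_derivative Dv (x0 + t *\<^sub>R y) \<bullet> y) (at t within {0..r})"
      by (simp add: has_field_derivative_def inner_commute mult.commute[of _ "y \<bullet> _"])
    then show "((\<lambda>t. ?f t y) has_real_derivative ?f' t y) (at t within {0..r})"
      by (rule DERIV_cmult_right)
  next
    fix t assume "t \<in> {0..r}"
    then show "?f t integrable_on ?Q"
      using cont_f integrable_continuous by blast
  next
    have "continuous_on ({0..r} \<times> ?Q) (\<lambda>p. ?f' (fst p) (snd p))"
      using in_\<Omega>
      by (auto intro!: continuous_intros continuous_on_compose2[OF cont(2)]
          continuous_on_compose2[OF continuous_on_bump[of UNIV]])
    then show "continuous_on ({0..r} \<times> ?Q) (\<lambda>(t, y). ?f' t y)"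
      by (simp add: case_prod_beta)
  qed (use assms(5) in auto)
  then have "((\<lambda>s. LINT y|lborel. ?f s y) has_real_derivative integral ?Q (?f' s)) (at s within {0..r})"
  proof (rule has_field_derivative_transform_within[where d = 1])
    show "integral ?Q (?f t) = (LINT y|lborel. ?f t y)" if "t \<in> {0..r}" for t
      using cont_f[OF that] zero by (intro to_HK) auto
  qed (use assms(5) in auto)
  moreover have "integral ?Q (?f' s) = (LINT y|lborel. ?f' s y)"
    using cont_f'[OF assms(5)] zero by (intro to_HK) auto
  ultimately show ?thesis
    by simp
qed

text \<open>
  On the ball of radius \<open>s \<le> R / 2\<close>, the large cutoff \<open>bump x0 R\<close> is at least \<open>3/4 * R\<^sup>2\<close>.
\<close>

lemma rescaled_inverse_power_bound:
  fixes v :: "real ^ 'n::finite \<Rightarrow> real"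
  assumes "open \<Omega>" "cball x0 R \<subseteq> \<Omega>" "0 < s" "s \<le> R / 2" "positive_solution \<Omega> v"
    and M: "(LINT x|lborel. v x powr (-13/2) * bump x0 R x ^ 8) \<le> M"
  shows "s ^ CARD('n) * (LINT y|lborel. v (x0 + s *\<^sub>R y) powr (-13/2) * (unit_bump y)\<^sup>2) \<le> (4 / (3 * R\<^sup>2)) ^ 8 * M"
proof -
  note v = positive_solutionD[OF assms(5)]
  have "R > 0"
    using assms(3,4) by simp
  have cont: "continuous_on \<Omega> v" "\<forall>x\<in>\<Omega>. v x \<noteq> 0"
    using C1_with_grad_imp_continuous_on[OF v(1)] v(3) by (auto simp: less_le)
  have K: "cball x0 s \<subseteq> \<Omega>"
    using assms(2-4) by auto
  let ?f = "\<lambda>x. v x powr (-13/2) * (bump x0 s x / s\<^sup>2)\<^sup>2"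
  let ?X = "\<lambda>x. v x powr (-13/2) * bump x0 R x ^ 8"
  have f0: "?f x = 0" if "x \<notin> cball x0 s" for x
    using bump_eq_0[of s x x0] that assms(3) by simp
  have contf: "continuous_on UNIV ?f"
    by (rule continuous_on_zero_extension[OF assms(1) compact_cball K])
      (use f0 cont assms(3) in \<open>auto intro!: continuous_intros\<close>)
  have intf: "integrable lborel ?f"
    using f0 by (intro integrable_compact_support[OF compact_cball continuous_on_subset[OF contf]]) auto
  have intX: "integrable lborel ?X"
  proof (rule integrable_compact_support[OF compact_cball])
    show "continuous_on (cball x0 R) ?X"
      using cont(2) continuous_on_subset[OF cont(1) assms(2)] assms(2)
      by (auto intro!: continuous_intros)
  qed (use bump_eq_0[of R _ x0] \<open>R > 0\<close> in simp)
  have "s ^ CARD('n) * (LINT y|lborel. ?f (x0 + s *\<^sub>R y)) = (LINT x|lborel. ?f x)"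
    using lborel_integral_dilate[OF contf assms(3), of x0] by simp
  also have "\<dots> \<le> (LINT x|lborel. (4 / (3 * R\<^sup>2)) ^ 8 * ?X x)"
  proof (rule integral_mono)
    fix x
    show "?f x \<le> (4 / (3 * R\<^sup>2)) ^ 8 * ?X x"
    proof (cases "x \<in> cball x0 s")
      case True
      then have "norm (x - x0) \<le> R / 2"
        using assms(4) by (simp add: dist_norm norm_minus_commute)
      then have "(norm (x - x0))\<^sup>2 \<le> (R / 2)\<^sup>2"
        by (intro power_mono) auto
      then have "3 / 4 * R\<^sup>2 \<le> bump x0 R x"
        unfolding bump_def power_divide by (intro max.coboundedI2) simp
      then have "1 \<le> 4 / (3 * R\<^sup>2) * bump x0 R x"
        using \<open>R > 0\<close> by (simp add: field_simps)
      then have "1 \<le> (4 / (3 * R\<^sup>2) * bump x0 R x) ^ 8"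
        by (rule one_le_power)
      moreover have "(bump x0 s x / s\<^sup>2)\<^sup>2 \<le> 1"
        using bump_le[of x0 s x] assms(3) by (intro power_le_one) auto
      ultimately have "v x powr (-13/2) * (bump x0 s x / s\<^sup>2)\<^sup>2 \<le> v x powr (-13/2) * (4 / (3 * R\<^sup>2) * bump x0 R x) ^ 8"
        by (intro mult_left_mono) auto
      then show ?thesis
        by (simp only: power_mult_distrib mult_ac)
    next
      case False
      then show ?thesis
        unfolding f0[OF False] by simp
    qed
  qed (use intf intX in simp_all)
  also have "\<dots> \<le> (4 / (3 * R\<^sup>2)) ^ 8 * M"
    using M by (simp add: mult_left_mono)
  finally show ?thesis
    using assms(3) by (simp add: bump_scale)
qed

text \<open>
  If \<open>t < s\<close>, then \<open>1/t = t powr (11/2) * t powr (-13/2)\<close> and the first factor increases with \<open>t\<close>.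
\<close>

lemma inverse_le_powr:
  fixes t s :: real
  assumes "0 < t" "0 < s"
  shows "1 / t \<le> 1 / s + s powr (11/2) * t powr (-13/2)"
proof (cases "s \<le> t")
  case True
  then have "1 / t \<le> 1 / s"
    using assms by (simp add: frac_le)
  then show ?thesis
    by (simp add: add_increasing2)
next
  case False
  have "1 / t = t powr (11/2) * t powr (-13/2)"
    using assms unfolding powr_add[symmetric] by (simp add: powr_minus_divide)
  also have "\<dots> \<le> s powr (11/2) * t powr (-13/2)"
    using False assms by (intro mult_right_mono powr_mono2) auto
  finally show ?thesis
    using assms(2) by (simp add: add_increasing)
qed

text \<open>
  This replaces Jensen's inequality for the convex function \<open>t powr (-13/2)\<close>: integrated with
  \<open>s\<close> a multiple of the mean of \<open>t\<close>, it bounds the mean of \<open>t powr (-13/2)\<close> from below.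
\<close>

lemma powr_ge_linear:
  fixes t s :: real
  assumes "0 < t" "0 < s"
  shows "s powr (-13/2) * (1 - t / s) \<le> t powr (-13/2)"
proof (cases "t \<le> s")
  case True
  then have "s powr (-13/2) * (1 - t / s) \<le> s powr (-13/2) * 1"
    using assms by (intro mult_left_mono) auto
  also have "\<dots> \<le> t powr (-13/2)"
    using True assms powr_mono2'[of "-13/2" t s] by simp
  finally show ?thesis .
next
  case False
  then have "s powr (-13/2) * (1 - t / s) \<le> 0"
    using assms by (intro mult_nonneg_nonpos) auto
  then show ?thesis
    by (rule order_trans) simp
qed

lemma positive_solution_ball:
  fixes v :: "real ^ 'n::finite \<Rightarrow> real"
  assumes "cball x0 R \<subseteq> \<Omega>" "positive_solution \<Omega> v" "0 \<le> s" "s \<le> R"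
  shows "\<And>y. y \<in> cball 0 1 \<Longrightarrow> 0 < v (x0 + s *\<^sub>R y)"
    and "continuous_on (cball 0 1) (\<lambda>y. v (x0 + s *\<^sub>R y))"
proof -
  have in_\<Omega>: "x0 + s *\<^sub>R y \<in> \<Omega>" if "y \<in> cball 0 1" for y
  proof -
    have "s * norm y \<le> R * 1"
      using that assms(3,4) by (intro mult_mono) auto
    then show ?thesis
      using assms(1) mult_le_imp_mem_cball[OF assms(3), of y R x0] by auto
  qed
  show "0 < v (x0 + s *\<^sub>R y)" if "y \<in> cball 0 1" for y
    using positive_solutionD(3)[OF assms(2) in_\<Omega>[OF that]] .
  show "continuous_on (cball 0 1) (\<lambda>y. v (x0 + s *\<^sub>R y))"
    using in_\<Omega>
    by (intro continuous_on_compose2[OF C1_with_grad_imp_continuous_on[OF positive_solutionD(1)[OF assms(2)]]]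
        continuous_intros) auto
qed

text \<open>
  By the mean value theorem in the dilation parameter it is enough to bound the derivative found in
  \<open>positive_solution_mean_deriv\<close>.  Splitting \<open>1/v\<close> at the height \<open>s\<close> produces the two terms
  \<open>s * (1/s)\<close> and \<open>s powr (13/2) * Q s\<close>, where \<open>s ^ n * Q s \<le> N\<close>; the latter stays bounded as
  \<open>s\<close> tends to 0 because \<open>n < 13/2\<close>.
\<close>

lemma positive_solution_mean_growth:
  fixes v :: "real ^ 'n::finite \<Rightarrow> real"
  assumes "CARD('n) < 7" "open \<Omega>" "cball x0 R \<subseteq> \<Omega>" "0 < r" "r \<le> 1" "real CARD('n) * r \<le> R"
    and "positive_solution \<Omega> v"
    and N: "\<And>s. 0 < s \<Longrightarrow> s \<le> r \<Longrightarrow>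
      s ^ CARD('n) * (LINT y|lborel. v (x0 + s *\<^sub>R y) powr (-13/2) * (unit_bump y)\<^sup>2) \<le> N"
  defines "w \<equiv> (LINT y|lborel. (unit_bump (y :: real ^ 'n))\<^sup>2)"
  shows "(LINT y|lborel. v (x0 + r *\<^sub>R y) * (unit_bump y)\<^sup>2) \<le> v x0 * w + r * (w + N)"
proof -
  let ?\<rho> = "unit_bump :: real ^ 'n \<Rightarrow> real"
  have "w > 0"
    unfolding w_def by (rule integral_unit_bump_pos)
  have "1 * r \<le> real CARD('n) * r"
    using assms(4) by (intro mult_right_mono) (auto simp: Suc_le_eq)
  then have "r \<le> R"
    using assms(6) by simp
  define I where "I s = (LINT y|lborel. v (x0 + s *\<^sub>R y) * (?\<rho> y)\<^sup>2)" for s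
  define Q where "Q s = (LINT y|lborel. v (x0 + s *\<^sub>R y) powr (-13/2) * (?\<rho> y)\<^sup>2)" for s
  have Q_nonneg: "0 \<le> Q s" for s
    unfolding Q_def by (intro integral_nonneg_AE) auto
  have "0 \<le> r ^ CARD('n) * Q r"
    using Q_nonneg[of r] assms(4) by simp
  also have "\<dots> \<le> N"
    using N[of r] assms(4) by (simp add: Q_def)
  finally have "N \<ge> 0" .
  define D where "D s = (LINT y|lborel. (grad v (x0 + s *\<^sub>R y) \<bullet> y) * (?\<rho> y)\<^sup>2)" for s
  have D_le: "D s \<le> w + N" if "0 < s" "s \<le> r" for s
  proof -
    let ?h = "\<lambda>y. (1 / s + s powr (11/2) * v (x0 + s *\<^sub>R y) powr (-13/2)) * (?\<rho> y)\<^sup>2"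
    have pos: "0 < v (x0 + s *\<^sub>R y)" if "y \<in> cball 0 1" for y
      using positive_solution_ball(1)[OF assms(3,7)] that \<open>0 < s\<close> \<open>s \<le> r\<close> \<open>r \<le> R\<close> by simp
    have cont: "continuous_on (cball 0 1) (\<lambda>y. v (x0 + s *\<^sub>R y))" "\<forall>y\<in>cball 0 1. v (x0 + s *\<^sub>R y) \<noteq> 0"
      using positive_solution_ball(2)[OF assms(3,7)] pos that \<open>r \<le> R\<close> by (simp_all add: less_le)
    have int_Q: "integrable lborel (\<lambda>y. v (x0 + s *\<^sub>R y) powr (-13/2) * (?\<rho> y)\<^sup>2)"
      using cont by (intro integrable_mult_unit_bump continuous_intros) auto
    have int_w: "integrable lborel (\<lambda>y. 1 / s * (?\<rho> y)\<^sup>2)"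
      by (intro integrable_mult_unit_bump continuous_intros) auto
    have "(LINT y|lborel. ?\<rho> y ^ 3 / v (x0 + s *\<^sub>R y)) \<le> (LINT y|lborel. ?h y)"
    proof (rule integral_mono)
      show "integrable lborel ?h"
        using cont by (intro integrable_mult_unit_bump continuous_intros) auto
      have "integrable lborel (\<lambda>y. 1 / v (x0 + s *\<^sub>R y) * ?\<rho> y ^ 3)"
        using cont by (intro integrable_mult_unit_bump continuous_intros) auto
      then show "integrable lborel (\<lambda>y. ?\<rho> y ^ 3 / v (x0 + s *\<^sub>R y))"
        by simp
      fix y :: "real ^ 'n"
      show "?\<rho> y ^ 3 / v (x0 + s *\<^sub>R y) \<le> ?h y"
      proof (cases "y \<in> cball 0 1")
        case True
        then have "0 < v (x0 + s *\<^sub>R y)"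
          using pos by simp
        moreover have "?\<rho> y ^ 3 \<le> (?\<rho> y)\<^sup>2"
          using unit_bump_le_1 by (intro power_decreasing) auto
        ultimately have "1 / v (x0 + s *\<^sub>R y) * ?\<rho> y ^ 3 \<le> ?h y"
          using inverse_le_powr[of "v (x0 + s *\<^sub>R y)" s] that by (intro mult_mono) auto
        then show ?thesis
          by simp
      qed (simp add: unit_bump_eq_0)
    qed
    also have "\<dots> = (LINT y|lborel. 1 / s * (?\<rho> y)\<^sup>2 + s powr (11/2) * (v (x0 + s *\<^sub>R y) powr (-13/2) * (?\<rho> y)\<^sup>2))"
      by (simp add: algebra_simps)
    also have "\<dots> = (LINT y|lborel. 1 / s * (?\<rho> y)\<^sup>2)
        + (LINT y|lborel. s powr (11/2) * (v (x0 + s *\<^sub>R y) powr (-13/2) * (?\<rho> y)\<^sup>2))"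
      by (intro Bochner_Integration.integral_add int_w integrable_mult_right int_Q)
    also have "\<dots> = 1 / s * w + s powr (11/2) * Q s"
      by (simp only: integral_mult_right_zero w_def Q_def)
    finally have "s / 6 * (LINT y|lborel. ?\<rho> y ^ 3 / v (x0 + s *\<^sub>R y)) \<le> s / 6 * (1 / s * w + s powr (11/2) * Q s)"
      using that by (intro mult_left_mono) auto
    then have "D s \<le> s / 6 * (1 / s * w + s powr (11/2) * Q s)"
      using positive_solution_mean_deriv[OF assms(2,3) that(1) _ assms(7)] that \<open>r \<le> R\<close> by (simp add: D_def)
    also have "\<dots> = w / 6 + s * s powr (11/2) * Q s / 6"
      using that by (simp add: field_simps)
    also have "s * s powr (11/2) = s powr (13/2)"
      using that powr_add[of s 1 "11/2"] by simp
    also have "s powr (13/2) * Q s \<le> s ^ CARD('n) * Q s"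
    proof (rule mult_right_mono)
      have "s powr (13/2) \<le> s powr (real CARD('n))"
        using that assms(1,5) by (intro powr_mono') auto
      then show "s powr (13/2) \<le> s ^ CARD('n)"
        using that by (simp add: powr_realpow)
      show "0 \<le> Q s"
        unfolding Q_def by (intro integral_nonneg_AE) auto
    qed
    also have "\<dots> \<le> N"
      using N that by (simp add: Q_def)
    finally show ?thesis
      using \<open>w > 0\<close> \<open>N \<ge> 0\<close> by simp
  qed
  have I': "(I has_real_derivative D s) (at s within {0..r})" if "s \<in> {0..r}" for s
    unfolding I_def[abs_def] D_def 
    by (rule has_derivative_mean[OF assms(3,4,6) positive_solutionD(1)[OF assms(7)] that])
  have "I r - I 0 \<le> r * (w + N)"
  proof -
    obtain s where s: "s \<in> {0<..<r}" "I r - I 0 = D s * (r - 0)"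
      using mvt_simple[OF assms(4), of I "\<lambda>s h. D s * h"] I' by (auto simp: has_field_derivative_def)
    then have "D s * r \<le> (w + N) * r"
      using D_le[of s] assms(4) by (intro mult_right_mono) auto
    then show ?thesis
      using s(2) by (simp add: mult.commute)
  qed
  moreover have "I 0 = v x0 * w"
    by (simp add: I_def w_def)
  ultimately have "I r \<le> v x0 * w + r * (w + N)"
    by simp
  then show ?thesis
    unfolding I_def .
qed

section \<open>The uniform lower bound\<close>

text \<open>
  The bound is a radius \<open>r\<close> itself.  If \<open>v x0 < r\<close>, the weighted mean of \<open>v\<close> at scale \<open>r\<close> is at most
  half of \<open>r * H\<close>, and comparing the resulting lower bound for the integral of \<open>v powr (-13/2)\<close> with the
  uniform upper bound gives \<open>r powr (-1/2) \<le> T\<close>, where \<open>H\<close> and \<open>T\<close> depend only on the ball.  The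
  condition \<open>r \<le> 1 / (T + 1)\<^sup>2\<close> excludes this.
\<close>

lemma stable_solution_lower_bound:
  fixes \<Omega> :: "(real ^ 'n::finite) set"
  assumes "CARD('n) < 7" "open \<Omega>" "x0 \<in> \<Omega>"
  obtains c where "c > 0" "\<And>v. positive_solution \<Omega> v \<Longrightarrow> stable_on \<Omega> v \<Longrightarrow> c \<le> v x0"
proof -
  obtain R where R: "R > 0" "cball x0 R \<subseteq> \<Omega>"
    using assms(2,3) by (auto simp: open_contains_cball)
  obtain M where M: "M \<ge> 0"
    "\<And>v. positive_solution \<Omega> v \<Longrightarrow> stable_on \<Omega> v \<Longrightarrow>
       (LINT x|lborel. v x powr (-13/2) * bump x0 R x ^ 8) \<le> M"
    using stable_inverse_power_bound[OF assms(2) R(2,1)] by blast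
  define N where "N = (4 / (3 * R\<^sup>2)) ^ 8 * M"
  define w where "w = (LINT y|lborel. (unit_bump (y :: real ^ 'n))\<^sup>2)"
  define H where "H = 2 * (2 * w + N) / w"
  define T where "T = 2 * N * H powr (13/2) / w"
  define r where "r = min (min 1 (R / 2)) (min (R / CARD('n)) (1 / (T + 1)\<^sup>2))"
  have "w > 0"
    unfolding w_def by (rule integral_unit_bump_pos)
  have "N \<ge> 0"
    using M(1) by (simp add: N_def)
  have "H > 0" "T \<ge> 0"
    using \<open>w > 0\<close> \<open>N \<ge> 0\<close> by (auto simp: H_def T_def add_pos_nonneg)
  have "0 < r"
    using R(1) \<open>T \<ge> 0\<close> by (simp add: r_def)
  then have r: "0 < r" "r \<le> 1" "r \<le> R / 2" "r \<le> R / CARD('n)" "r \<le> 1 / (T + 1)\<^sup>2"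
    unfolding r_def by linarith+
  show thesis
  proof (rule that[OF r(1)])
    fix v :: "real ^ 'n \<Rightarrow> real"
    assume v: "positive_solution \<Omega> v" "stable_on \<Omega> v"
    let ?\<rho> = "unit_bump :: real ^ 'n \<Rightarrow> real"
    have "r \<le> R"
      using r(1,3) by simp
    have pos: "0 < v (x0 + r *\<^sub>R y)" if "y \<in> cball 0 1" for y
      using positive_solution_ball(1)[OF R(2) v(1)] that r(1) \<open>r \<le> R\<close> by simp
    have cont: "continuous_on (cball 0 1) (\<lambda>y. v (x0 + r *\<^sub>R y))" "\<forall>y\<in>cball 0 1. v (x0 + r *\<^sub>R y) \<noteq> 0"
      using positive_solution_ball(2)[OF R(2) v(1)] pos r(1) \<open>r \<le> R\<close> by (simp_all add: less_le)
    define I where "I s = (LINT y|lborel. v (x0 + s *\<^sub>R y) * (?\<rho> y)\<^sup>2)" for s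
    define Q where "Q s = (LINT y|lborel. v (x0 + s *\<^sub>R y) powr (-13/2) * (?\<rho> y)\<^sup>2)" for s
    have Q: "s ^ CARD('n) * Q s \<le> N" if "0 < s" "s \<le> r" for s
      unfolding Q_def N_def
      using that r(3) by (intro rescaled_inverse_power_bound[OF assms(2) R(2) _ _ v(1) M(2)[OF v]]) auto
    have I_le: "I r \<le> v x0 * w + r * (w + N)"
      unfolding I_def w_def
    proof (rule positive_solution_mean_growth[OF assms(1,2) R(2) r(1,2) _ v(1)])
      show "real CARD('n) * r \<le> R"
        using r(4) by (simp add: field_simps)
    qed (use Q in \<open>simp add: Q_def\<close>)
    show "r \<le> v x0"
    proof (rule ccontr)
      assume "\<not> r \<le> v x0"
      define \<Lambda> where "\<Lambda> = r * H"
      have int_1: "integrable lborel (\<lambda>y. (?\<rho> y)\<^sup>2)"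
        using integrable_mult_unit_bump[of "\<lambda>_. 1" 2] by simp
      have int_v: "integrable lborel (\<lambda>y. v (x0 + r *\<^sub>R y) * (?\<rho> y)\<^sup>2)"
        using cont(1) by (intro integrable_mult_unit_bump) auto
      have "\<Lambda> > 0"
        using r(1) \<open>H > 0\<close> by (simp add: \<Lambda>_def)
      have "v x0 * w \<le> r * w"
        using \<open>\<not> r \<le> v x0\<close> \<open>w > 0\<close> by (intro mult_right_mono) auto
      then have "I r \<le> r * (2 * w + N)"
        using I_le by (simp add: algebra_simps)
      also have "\<dots> = \<Lambda> * (w / 2)"
        using \<open>w > 0\<close> by (simp add: \<Lambda>_def H_def)
      finally have "w / 2 \<le> w - I r / \<Lambda>"
        using \<open>\<Lambda> > 0\<close> by (simp add: field_simps)
      then have "\<Lambda> powr (-13/2) * (w / 2) \<le> \<Lambda> powr (-13/2) * (w - I r / \<Lambda>)"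
        by (intro mult_left_mono) auto
      also have "\<dots> = (LINT y|lborel. \<Lambda> powr (-13/2) * ((?\<rho> y)\<^sup>2 - v (x0 + r *\<^sub>R y) * (?\<rho> y)\<^sup>2 / \<Lambda>))"
        using Bochner_Integration.integral_diff[OF int_1 integrable_divide_zero[OF int_v, of \<Lambda>]]
        by (simp add: w_def I_def)
      also have "\<dots> \<le> Q r"
        unfolding Q_def
      proof (rule integral_mono)
        show "integrable lborel (\<lambda>y. \<Lambda> powr (-13/2) * ((?\<rho> y)\<^sup>2 - v (x0 + r *\<^sub>R y) * (?\<rho> y)\<^sup>2 / \<Lambda>))"
          using int_1 int_v by simp
        show "integrable lborel (\<lambda>y. v (x0 + r *\<^sub>R y) powr (-13/2) * (?\<rho> y)\<^sup>2)"
          using cont by (intro integrable_mult_unit_bump continuous_intros) auto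
        fix y :: "real ^ 'n"
        show "\<Lambda> powr (-13/2) * ((?\<rho> y)\<^sup>2 - v (x0 + r *\<^sub>R y) * (?\<rho> y)\<^sup>2 / \<Lambda>)
            \<le> v (x0 + r *\<^sub>R y) powr (-13/2) * (?\<rho> y)\<^sup>2"
        proof (cases "y \<in> cball 0 1")
          case True
          then have "\<Lambda> powr (-13/2) * (1 - v (x0 + r *\<^sub>R y) / \<Lambda>) \<le> v (x0 + r *\<^sub>R y) powr (-13/2)"
            using pos \<open>\<Lambda> > 0\<close> by (intro powr_ge_linear) auto
          then have "\<Lambda> powr (-13/2) * (1 - v (x0 + r *\<^sub>R y) / \<Lambda>) * (?\<rho> y)\<^sup>2 \<le> v (x0 + r *\<^sub>R y) powr (-13/2) * (?\<rho> y)\<^sup>2"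
            by (intro mult_right_mono) auto
          then show ?thesis
            by (simp add: algebra_simps)
        qed (simp add: unit_bump_eq_0)
      qed
      finally have "r ^ CARD('n) * (\<Lambda> powr (-13/2) * (w / 2)) \<le> r ^ CARD('n) * Q r"
        using r(1) by (intro mult_left_mono) auto
      also have "\<dots> \<le> N"
        using Q r(1) by simp
      finally have "r ^ CARD('n) * (\<Lambda> powr (-13/2) * (w / 2)) \<le> N" .
      moreover have "r ^ 6 \<le> r ^ CARD('n)"
        using r(1,2) assms(1) by (intro power_decreasing) auto
      then have "r ^ 6 * (\<Lambda> powr (-13/2) * (w / 2)) \<le> r ^ CARD('n) * (\<Lambda> powr (-13/2) * (w / 2))"
        using \<open>w > 0\<close> by (intro mult_right_mono) auto
      ultimately have "r ^ 6 * (\<Lambda> powr (-13/2)) * (w / 2) \<le> N"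
        by simp
      moreover have "r ^ 6 * \<Lambda> powr (-13/2) = r powr (-1/2) * H powr (-13/2)"
      proof -
        have "r ^ 6 * r powr (-13/2) = r powr 6 * r powr (-13/2)"
          using r(1) by simp
        also have "\<dots> = r powr (-1/2)"
          unfolding powr_add[symmetric] by simp
        finally show ?thesis
          using r(1) \<open>H > 0\<close> by (simp add: \<Lambda>_def powr_mult)
      qed
      ultimately have "r powr (-1/2) * H powr (-13/2) * (w / 2) \<le> N"
        by simp
      moreover have "a \<le> 2 * N * h / w" if "a * (1 / h) * (w / 2) \<le> N" "h > 0" for a h
        using that \<open>w > 0\<close> by (simp add: field_simps)
      ultimately have "r powr (-1/2) \<le> T"
        using \<open>H > 0\<close> by (simp add: T_def powr_minus_divide)
      moreover have "T + 1 \<le> r powr (-1/2)"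
      proof -
        have "T + 1 = (1 / (T + 1)\<^sup>2) powr (-1/2)"
          using \<open>T \<ge> 0\<close> by (simp add: powr_minus powr_half_sqrt real_sqrt_divide)
        also have "\<dots> \<le> r powr (-1/2)"
          using r(1,5) by (intro powr_mono2') auto
        finally show ?thesis .
      qed
      ultimately show False
        by simp
    qed
  qed
qed

theorem corollary4:
  fixes \<Omega> :: "(real ^ 'n::finite) set"
  assumes "CARD('n) < 7"
    and "open \<Omega>" and "connected \<Omega>" and "\<Omega> \<noteq> {}"
  shows "\<nexists>u. singular_stable_solution \<Omega> u"
proof
  assume "\<exists>u. singular_stable_solution \<Omega> u"
  then obtain u v x0 where v: "\<And>j. positive_solution \<Omega> (v j)" "\<And>j. stable_on \<Omega> (v j)"
    and lim: "uniform_limit \<Omega> v u sequentially" and x0: "x0 \<in> \<Omega>" "u x0 = 0"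
    unfolding singular_stable_solution_def by blast
  obtain c where c: "c > 0" "\<And>v. positive_solution \<Omega> v \<Longrightarrow> stable_on \<Omega> v \<Longrightarrow> c \<le> v x0"
    using stable_solution_lower_bound[OF assms(1,2) x0(1)] by blast
  have "(\<lambda>j. v j x0) \<longlonglongrightarrow> u x0"
    using lim x0(1) by (rule tendsto_uniform_limitI)
  then have "c \<le> u x0"
    using c(2)[OF v] by (intro LIMSEQ_le_const) auto
  then show False
    using c(1) x0(2) by simp
qed

end
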